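(* Let $N\ge 2$ be an integer, $s\in(1,2)$, $\sigma=s-1$, $p\in(1,\frac{N}{s})$ and $a\in[0,\frac{N-sp}{2})$. Then there is a constant $C=C(N,p,\sigma,a)>0$ such that $$\iint_{\mathbb{R}^N\times\mathbb{R}^N}\frac{|\nabla u(x)-\nabla u(y)|^p}{|x-y|^{N+\sigma p}}\,\frac{dx}{|x|^a}\frac{dy}{|y|^a}\ \ge\ C\int_{\mathbb{R}^N}\frac{|u(x)|^p}{|x|^{sp+2a}}\,dx\qquad\text{for all }u\in \mathcal{C}_c^\infty(\mathbb{R}^N).$$
   Context: $\mathcal{C}_c^\infty(\mathbb{R}^N)$ is the space of smooth compactly supported functions on $\mathbb{R}^N$. *)

theory Defs
  imports "HOL-Analysis.Analysis"
begin

text \<open>Continuous differentiability on the whole space: \<open>f\<close> is \<open>C\<^sup>k\<^sup>+\<^sup>1\<close> iff it is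
  differentiable and every directional derivative (in a fixed direction \<open>v\<close>) is \<open>C\<^sup>k\<close>.\<close>

primrec Ck :: "nat \<Rightarrow> ('a::euclidean_space \<Rightarrow> real) \<Rightarrow> bool" where
  "Ck 0 f \<longleftrightarrow> continuous_on UNIV f"
| "Ck (Suc k) f \<longleftrightarrow> (\<forall>x. f differentiable (at x)) \<and>
     (\<forall>v. Ck k (\<lambda>x. frechet_derivative f (at x) v))"

definition Cc_infty :: "('a::euclidean_space \<Rightarrow> real) set" where
  "Cc_infty = {f. (\<forall>k. Ck k f) \<and> compact (closure {x. f x \<noteq> 0})}"

definition grad :: "('a::euclidean_space \<Rightarrow> real) \<Rightarrow> 'a \<Rightarrow> 'a" where
  "grad f x = (THE D. GDERIV f x :> D)"

end

theory Submission
  imports Defs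
begin

text \<open>
  Put \<open>w = \<nabla>u\<close>. The inequality is the composition of a fractional Hardy inequality for \<open>w\<close>, with
  weight \<open>|x|\<close> to the power \<open>-(\<sigma>p + 2a)\<close>, and of the classical weighted Hardy inequality for \<open>u\<close>.
  Both follow by comparing the values at \<open>x\<close> with those at points \<open>R\<close> times farther from the origin:
  \<open>w x\<close> with \<open>w y\<close> averaged over the annulus \<open>R|x| < |y| \<le> 2R|x|\<close>, and \<open>u x\<close> with \<open>u (R x)\<close>.
  As the weight exponent is below the dimension, the contribution of the far points is at most half of
  the left-hand side once \<open>R\<close> is large, and it can be absorbed. Absorption needs a finite left-hand side,
  which is ensured by restricting it to \<open>|x| > d\<close>; dilating outwards respects this restriction.
\<close>

section \<open>Absorption, dilation and truncation for nonnegative integrals\<close>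

text \<open>One of the two halves of \<open>A * J\<close> is cancelled against the right-hand side.
  In \<open>ennreal\<close> such a cancellation is valid because \<open>J\<close> is finite.\<close>

lemma ennreal_absorb_half:
  fixes A :: real and B J :: ennreal
  assumes "J < top" "0 < A" "ennreal A * J \<le> B + ennreal (A / 2) * J"
  shows "ennreal (A / 2) * J \<le> B"
proof -
  have "ennreal A * J = ennreal (A / 2) * J + ennreal (A / 2) * J"
    using \<open>0 < A\<close> by (simp flip: ennreal_plus distrib_right)
  then have "ennreal (A / 2) * J + ennreal (A / 2) * J \<le> ennreal (A / 2) * J + B"
    using assms(3) by (simp add: add.commute)
  moreover have "ennreal (A / 2) * J < top"
    using assms(1) by (simp add: ennreal_mult_less_top)
  ultimately show ?thesis
    by (auto simp: ennreal_add_left_cancel_le)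
qed

lemma ennreal_divide_mult_le:
  fixes A c :: real and D J :: ennreal
  assumes "ennreal A * J \<le> ennreal c * D" "0 < A" "0 < c"
  shows "ennreal (A / c) * J \<le> D"
proof -
  have "ennreal (A / c) * J = ennreal (1 / c) * (ennreal A * J)"
    using assms by (simp flip: mult.assoc ennreal_mult)
  also have "\<dots> \<le> ennreal (1 / c) * (ennreal c * D)"
    using assms(1) by (rule mult_left_mono) simp
  also have "\<dots> = D"
    using assms by (simp flip: mult.assoc ennreal_mult)
  finally show ?thesis .
qed

lemma nn_integral_lborel_scaleR:
  fixes f :: "'a::euclidean_space \<Rightarrow> ennreal"
  assumes [measurable]: "f \<in> borel_measurable borel" and "0 < c"
  shows "(\<integral>\<^sup>+x. f (c *\<^sub>R x) \<partial>lborel) = ennreal (1 / c ^ DIM('a)) * (\<integral>\<^sup>+x. f x \<partial>lborel)"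
proof -
  have "(\<integral>\<^sup>+x. f x \<partial>lborel) =
      (\<integral>\<^sup>+x. f x \<partial>density (distr lborel borel (\<lambda>x::'a. 0 + c *\<^sub>R x)) (\<lambda>_. \<bar>c\<bar>^DIM('a)))"
    using lborel_affine[of c "0::'a"] \<open>0 < c\<close> by simp
  also have "\<dots> = ennreal (c ^ DIM('a)) * (\<integral>\<^sup>+x. f (c *\<^sub>R x) \<partial>lborel)"
    using \<open>0 < c\<close> by (simp add: nn_integral_density nn_integral_distr nn_integral_cmult)
  finally have "ennreal (1 / c ^ DIM('a)) * (\<integral>\<^sup>+x. f x \<partial>lborel) =
      (ennreal (1 / c ^ DIM('a)) * ennreal (c ^ DIM('a))) * (\<integral>\<^sup>+x. f (c *\<^sub>R x) \<partial>lborel)"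
    by (simp add: mult.assoc)
  then show ?thesis
    using \<open>0 < c\<close> by (simp flip: ennreal_mult)
qed

text \<open>The sets \<open>1 / Suc n < norm x\<close> increase to the complement of the origin, so
  monotone convergence applies. At the origin every truncation is 0, which agrees with
  \<open>f 0 = 0\<close>, so the supremum is \<open>f\<close> everywhere.\<close>

lemma nn_integral_le_of_truncations:
  fixes f :: "'a::euclidean_space \<Rightarrow> ennreal"
  assumes [measurable]: "f \<in> borel_measurable borel" and "f 0 = 0"
    and B: "\<And>d. 0 < d \<Longrightarrow> (\<integral>\<^sup>+x. indicator {x. d < norm x} x * f x \<partial>lborel) \<le> B"
  shows "(\<integral>\<^sup>+x. f x \<partial>lborel) \<le> B"
proof -
  define g where "g n x = indicator {x. 1 / Suc n < norm x} x * f x" for n x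
  have g_meas: "g n \<in> borel_measurable lborel" for n
    unfolding g_def by measurable
  have "incseq g"
    unfolding g_def by (intro incseq_SucI le_funI mult_right_mono)
      (auto simp: indicator_def elim!: le_less_trans[rotated] intro!: frac_le)
  have "(SUP n. g n x) = f x" for x
  proof (rule antisym)
    show "(SUP n. g n x) \<le> f x"
      by (rule SUP_least) (auto simp: g_def indicator_def)
    show "f x \<le> (SUP n. g n x)"
    proof (cases "x = 0")
      case False
      then obtain n where "inverse (real (Suc n)) < norm x"
        using reals_Archimedean[of "norm x"] by auto
      then have "f x = g n x"
        by (simp add: g_def inverse_eq_divide)
      then show ?thesis
        by (metis SUP_upper UNIV_I)
    qed (simp add: assms)
  qed
  then have "(\<integral>\<^sup>+x. f x \<partial>lborel) = (SUP n. \<integral>\<^sup>+x. g n x \<partial>lborel)"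
    using nn_integral_monotone_convergence_SUP[OF \<open>incseq g\<close> g_meas] by simp
  also have "\<dots> \<le> B"
    unfolding g_def by (intro SUP_least B) simp
  finally show ?thesis .
qed

text \<open>The singularity of the weight is cut off so that the quantity to be absorbed is finite.
  The function is vector valued so that one notion serves both \<open>grad u\<close> and the scalar
  \<open>u\<close>.\<close>

definition truncated_weighted_integral ::
    "real \<Rightarrow> real \<Rightarrow> real \<Rightarrow> ('a::euclidean_space \<Rightarrow> 'b::euclidean_space) \<Rightarrow> ennreal"
  where "truncated_weighted_integral p \<beta> d w =
    (\<integral>\<^sup>+x. indicator {x. d < norm x} x * ennreal (norm (w x) powr p / norm x powr \<beta>) \<partial>lborel)"

text \<open>On a ball containing the support, \<open>w\<close> is bounded by compactness, and beyond
  radius \<open>d\<close> the weight is at most \<open>1 / d powr \<beta>\<close>. The integrand is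
  thus dominated by a constant on a ball.\<close>

lemma truncated_weighted_integral_finite:
  fixes w :: "'a::euclidean_space \<Rightarrow> 'b::euclidean_space"
  assumes w: "continuous_on UNIV w" and supp: "bounded {x. w x \<noteq> 0}"
    and "0 < p" "0 \<le> \<beta>" "0 < d"
  shows "truncated_weighted_integral p \<beta> d w < top"
proof -
  obtain r where r: "\<And>x. w x \<noteq> 0 \<Longrightarrow> norm x \<le> r"
    using supp by (auto simp: bounded_iff)
  have "bounded (w ` cball 0 r)"
    by (intro compact_imp_bounded compact_continuous_image continuous_on_subset[OF w]) auto
  then obtain M where M: "\<And>x. norm x \<le> r \<Longrightarrow> norm (w x) \<le> M"
    by (force simp: bounded_iff)
  have "truncated_weighted_integral p \<beta> d w \<le>
      (\<integral>\<^sup>+x. ennreal (M powr p / d powr \<beta>) * indicator (cball (0::'a) r) x \<partial>lborel)"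
    unfolding truncated_weighted_integral_def
  proof (rule nn_integral_mono)
    fix x :: 'a
    have "norm (w x) powr p / norm x powr \<beta> \<le> M powr p / d powr \<beta>"
      if "d < norm x" "w x \<noteq> 0"
      using that M[OF r] \<open>0 < d\<close> assms(3,4) by (intro frac_le powr_mono2) auto
    then show "indicator {x. d < norm x} x * ennreal (norm (w x) powr p / norm x powr \<beta>)
        \<le> ennreal (M powr p / d powr \<beta>) * indicator (cball 0 r) x"
      using r[of x] by (cases "w x = 0") (auto simp: indicator_def intro!: ennreal_leI)
  qed
  also have "\<dots> = ennreal (M powr p / d powr \<beta>) * emeasure lborel (cball (0::'a) r)"
    by (rule nn_integral_cmult_indicator) simp
  also have "\<dots> < top"
    using emeasure_lborel_cball_finite[of "0::'a" r] by (simp add: ennreal_mult_less_top)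
  finally show ?thesis .
qed

section \<open>Elementary estimates for real powers\<close>

text \<open>Bounding \<open>b + c\<close> by twice the maximum gives a crude constant but avoids
  convexity, so the range \<open>p < 1\<close> is covered too.\<close>

lemma powr_add_le:
  fixes b c :: real
  assumes "0 \<le> b" "0 \<le> c" "0 \<le> p"
  shows "(b + c) powr p \<le> 2 powr p * (b powr p + c powr p)"
proof -
  have "(b + c) powr p \<le> (2 * max b c) powr p"
    using assms by (intro powr_mono2) auto
  also have "\<dots> = 2 powr p * max b c powr p"
    using assms by (simp add: powr_mult)
  also have "\<dots> \<le> 2 powr p * (b powr p + c powr p)"
    by (intro mult_left_mono) (auto simp: max_def)
  finally show ?thesis .
qed

lemma norm_powr_le_2_powr:
  fixes b c :: "'b::real_normed_vector"
  assumes "0 \<le> p"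
  shows "norm b powr p \<le> 2 powr p * (norm (b - c) powr p + norm c powr p)"
proof -
  have "norm b powr p \<le> (norm (b - c) + norm c) powr p"
    using assms norm_triangle_sub[of b c] by (intro powr_mono2) (auto simp: add.commute)
  then show ?thesis
    using powr_add_le[of "norm (b - c)" "norm c" p] assms by simp
qed

lemma exists_large_powr:
  fixes \<kappa> M :: real
  assumes "0 < \<kappa>"
  shows "\<exists>R>1. M \<le> R powr \<kappa>"
proof (intro exI conjI)
  \<comment> \<open>The maximum with 2 keeps the base above 1, whatever \<open>M\<close> is, so that
    the witness exceeds 1.\<close>
  show "max M 2 powr (1 / \<kappa>) > 1"
    using assms by (intro gr_one_powr) auto
  show "M \<le> (max M 2 powr (1 / \<kappa>)) powr \<kappa>"
    using assms by (simp add: powr_powr)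
qed

section \<open>The fractional Hardy inequality\<close>

text \<open>When \<open>y\<close> lies in the annulus of \<open>x\<close>, both
  \<open>norm y\<close> and \<open>norm (x - y)\<close> are at most a multiple of
  \<open>norm x\<close>. In the difference term the weight of \<open>x\<close> can therefore be
  traded for the kernel: the power \<open>e\<close> goes to \<open>x - y\<close>, one power
  \<open>a\<close> stays at \<open>x\<close>, the other goes to \<open>y\<close>. In the far term
  the whole weight moves to \<open>y\<close>.\<close>

lemma fractional_hardy_pointwise:
  fixes x y :: "'a::real_normed_vector" and wx wy :: "'b::real_normed_vector"
  assumes "1 < R" "0 \<le> p" "0 \<le> e" "0 \<le> a" "x \<noteq> 0"
    and yR: "R * norm x \<le> norm y" "norm y \<le> 2 * R * norm x"
  shows "norm wx powr p / norm x powr (e + 2 * a) \<le>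
    (2 powr p * (2 * R + 1) powr e * (2 * R) powr a) *
      (norm (wx - wy) powr p / norm (x - y) powr e * (1 / norm x powr a) * (1 / norm y powr a))
    + (2 powr p * (2 * R) powr (e + 2 * a)) * (norm wy powr p / norm y powr (e + 2 * a))"
proof -
  have x: "0 < norm x"
    using assms by simp
  have xy: "norm x < norm y"
  proof -
    have "1 * norm x < R * norm x"
      using x \<open>1 < R\<close> by (intro mult_strict_right_mono) auto
    then show ?thesis using yR by simp
  qed
  then have y: "0 < norm y" and xmy: "0 < norm (x - y)"
    using x by auto
  have dist_le: "norm (x - y) \<le> (2 * R + 1) * norm x"
    using norm_triangle_ineq4[of x y] yR by (simp add: algebra_simps)
  have e_le: "1 / norm x powr e \<le> (2 * R + 1) powr e / norm (x - y) powr e"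
  proof -
    have "norm (x - y) powr e \<le> (2 * R + 1) powr e * norm x powr e"
      using powr_mono2[OF _ _ dist_le, of e] assms by (simp add: powr_mult)
    then show ?thesis
      using x xmy by (simp add: field_simps)
  qed
  have y_le: "1 / norm x powr b \<le> (2 * R) powr b / norm y powr b" if "0 \<le> b" for b
  proof -
    have "norm y powr b \<le> (2 * R) powr b * norm x powr b"
      using powr_mono2[OF _ _ yR(2), of b] that assms by (simp add: powr_mult)
    then show ?thesis
      using x y by (simp add: field_simps)
  qed
  have split: "norm x powr (e + 2 * a) = norm x powr e * norm x powr a * norm x powr a"
    using powr_add[of "norm x" "e + a" a] by (simp add: powr_add)
  have "1 / norm x powr (e + 2 * a) = (1 / norm x powr e) * (1 / norm x powr a) * (1 / norm x powr a)"
    by (simp add: split)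
  also have "\<dots> \<le> ((2 * R + 1) powr e / norm (x - y) powr e) * (1 / norm x powr a) *
      ((2 * R) powr a / norm y powr a)"
    using e_le y_le[OF \<open>0 \<le> a\<close>] by (intro mult_mono) auto
  finally have kernel: "1 / norm x powr (e + 2 * a) \<le> \<dots>" .
  have "norm wx powr p / norm x powr (e + 2 * a) \<le>
      2 powr p * (norm (wx - wy) powr p + norm wy powr p) * (1 / norm x powr (e + 2 * a))"
    using norm_powr_le_2_powr[OF \<open>0 \<le> p\<close>, of wx wy] by (simp add: divide_right_mono)
  also have "\<dots> = 2 powr p * norm (wx - wy) powr p * (1 / norm x powr (e + 2 * a)) +
      2 powr p * norm wy powr p * (1 / norm x powr (e + 2 * a))"
    by (simp add: algebra_simps add_divide_distrib)
  also have "\<dots> \<le> 2 powr p * norm (wx - wy) powr p *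
        (((2 * R + 1) powr e / norm (x - y) powr e) * (1 / norm x powr a) * ((2 * R) powr a / norm y powr a)) +
      2 powr p * norm wy powr p * ((2 * R) powr (e + 2 * a) / norm y powr (e + 2 * a))"
    using kernel y_le[of "e + 2 * a"] assms by (intro add_mono mult_left_mono) auto
  finally show ?thesis
    by (simp add: mult_ac)
qed

text \<open>The volume of the annulus is \<open>2 ^ DIM('a) - 1\<close> times the left-hand side,
  and this factor is at least 1 because the dimension is positive.\<close>

lemma emeasure_annulus_ge:
  fixes r R :: real
  assumes "0 \<le> r" "0 \<le> R"
  shows "ennreal (unit_ball_vol (DIM('a::euclidean_space)) * (R * r) ^ DIM('a))
    \<le> emeasure lborel {y::'a. R * r < norm y \<and> norm y \<le> 2 * R * r}"
proof -
  let ?v = "unit_ball_vol (DIM('a))"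
  have eq: "{y::'a. R * r < norm y \<and> norm y \<le> 2 * R * r} = cball 0 (2 * R * r) - cball 0 (R * r)"
    by auto
  have "emeasure lborel (cball (0::'a) (2 * R * r) - cball 0 (R * r)) =
      emeasure lborel (cball (0::'a) (2 * R * r)) - emeasure lborel (cball (0::'a) (R * r))"
  proof (rule emeasure_Diff)
    have "R * r \<le> 2 * R * r"
      using assms by simp
    then show "cball (0::'a) (R * r) \<subseteq> cball 0 (2 * R * r)"
      by auto
  qed (use emeasure_lborel_cball_finite[of "0::'a" "R * r"] in auto)
  also have "\<dots> = ennreal (?v * (2 * R * r) ^ DIM('a) - ?v * (R * r) ^ DIM('a))"
    using assms by (simp add: emeasure_cball ennreal_minus)
  also have "\<dots> = ennreal ((2 ^ DIM('a) - 1) * (?v * (R * r) ^ DIM('a)))"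
    by (simp add: power_mult_distrib algebra_simps)
  also have "\<dots> \<ge> ennreal (1 * (?v * (R * r) ^ DIM('a)))"
  proof (intro ennreal_leI mult_right_mono)
    have "(2::real) ^ 1 \<le> 2 ^ DIM('a)"
      by (intro power_increasing) (auto simp: Suc_leI)
    then show "(1::real) \<le> 2 ^ DIM('a) - 1" by simp
  qed (use assms in auto)
  finally show ?thesis
    by (simp add: eq)
qed

text \<open>The pointwise estimate is integrated over all pairs with \<open>y\<close> in the annulus
  of \<open>x\<close>. On the left, integration in \<open>y\<close> yields a volume of order
  \<open>R ^ n * norm x ^ n\<close>. In the far term, integration in \<open>x\<close> yields only
  \<open>norm y ^ n / R ^ n\<close>. Up to a fixed factor, the ratio of far term to left-hand side
  is \<open>R\<close> to the power \<open>e + 2 * a - 2 * n\<close>, a negative exponent.\<close>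

theorem fractional_hardy:
  fixes p e a :: real
  assumes "0 < p" "0 \<le> a" "real DIM('a) \<le> e + 2 * a" "e + 2 * a < 2 * real DIM('a)" "0 \<le> e"
  shows "\<exists>C>0. \<forall>w :: 'a::euclidean_space \<Rightarrow> 'b::euclidean_space. continuous_on UNIV w \<longrightarrow> bounded {x. w x \<noteq> 0} \<longrightarrow>
    (\<forall>d>0. ennreal C * truncated_weighted_integral p (e + 2 * a - DIM('a)) d w \<le>
    (\<integral>\<^sup>+(x, y). ennreal (norm (w x - w y) powr p / norm (x - y) powr e
        * (1 / norm x powr a) * (1 / norm y powr a)) \<partial>(lborel \<Otimes>\<^sub>M lborel)))"
proof -
  define n where "n = DIM('a)"
  define \<nu> where "\<nu> = unit_ball_vol (real n)"
  have "0 < \<nu>" "0 \<le> \<nu>" by (auto simp: \<nu>_def)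
  \<comment> \<open>Multiplied by \<open>R powr (e + 2 * a)\<close>, this condition reads
    \<open>2 * c2 \<le> R ^ (2 * n)\<close>, which is what makes the far term at most half of the
    left-hand side.\<close>
  obtain R where R: "1 < R" "2 * (2 powr p * 2 powr (e + 2 * a)) \<le> R powr (2 * real n - (e + 2 * a))"
    using exists_large_powr[of "2 * real n - (e + 2 * a)"] assms unfolding n_def by auto
  \<comment> \<open>\<open>c1\<close> and \<open>c2\<close> are the constants of the pointwise
    estimate; \<open>A\<close> is the lower bound for the annulus volume, divided by
    \<open>norm x ^ n\<close>.\<close>
  define c1 where "c1 = 2 powr p * (2 * R + 1) powr e * (2 * R) powr a"
  define c2 where "c2 = 2 powr p * (2 * R) powr (e + 2 * a)"
  define A where "A = \<nu> * R ^ n"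
  have "0 < A" "0 < c1" "0 \<le> c2"
    using R \<open>0 < \<nu>\<close> by (auto simp: A_def c1_def c2_def)
  have c2: "c2 * (\<nu> / R ^ n) \<le> A / 2"
  proof -
    have "2 * c2 = 2 * (2 powr p * 2 powr (e + 2 * a)) * R powr (e + 2 * a)"
      using R by (simp add: c2_def powr_mult)
    also have "\<dots> \<le> R powr (2 * real n - (e + 2 * a)) * R powr (e + 2 * a)"
      using R by (intro mult_right_mono) auto
    also have "\<dots> = R ^ n * R ^ n"
      using R by (simp add: powr_realpow flip: powr_add power_add mult_2)
         (metis less_trans mult_2 of_nat_add powr_realpow zero_less_one)
    finally have "2 * c2 \<le> R ^ n * R ^ n" .
    then have "\<nu> * (2 * c2) \<le> \<nu> * (R ^ n * R ^ n)"
      using \<open>0 \<le> \<nu>\<close> by (rule mult_left_mono)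
    then show ?thesis
      using R by (simp add: A_def field_simps)
  qed
  show ?thesis
  proof (intro exI[of _ "A / 2 / c1"] conjI allI impI)
    show "0 < A / 2 / c1" using \<open>0 < A\<close> \<open>0 < c1\<close> by simp
    fix w :: "'a \<Rightarrow> 'b" and d :: real
    assume w: "continuous_on UNIV w" and supp: "bounded {x. w x \<noteq> 0}" and "0 < d"
    have [measurable]: "w \<in> borel_measurable borel"
      using w by (rule borel_measurable_continuous_onI)
    define J where "J = truncated_weighted_integral p (e + 2 * a - n) d w"
    define K where "K = (\<lambda>(x, y). ennreal (norm (w x - w y) powr p / norm (x - y) powr e
        * (1 / norm x powr a) * (1 / norm y powr a)))"
    \<comment> \<open>The truncation and the annulus condition are encoded as one indicator on the
      product space, which makes joint measurability, and hence Fubini, available.\<close>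
    define T :: "'a \<Rightarrow> 'a \<Rightarrow> ennreal" where "T x y = indicator
      {z. d < norm (fst z) \<and> R * norm (fst z) < norm (snd z) \<and> norm (snd z) \<le> 2 * R * norm (fst z)} (x, y)" for x y
    have [measurable]: "case_prod T \<in> borel_measurable (lborel \<Otimes>\<^sub>M lborel)"
      unfolding T_def by measurable
    have [measurable]: "K \<in> borel_measurable (lborel \<Otimes>\<^sub>M lborel)"
      unfolding K_def by measurable
    define D where "D = (\<integral>\<^sup>+z. K z \<partial>(lborel \<Otimes>\<^sub>M lborel))"
    define h where "h b x = ennreal (norm (w x) powr p / norm x powr b)" for b x
    have [measurable]: "h b \<in> borel_measurable lborel" for b
      unfolding h_def by measurable
    have "J < top"
      unfolding J_def using assms \<open>0 < d\<close> w supp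
      by (intro truncated_weighted_integral_finite) (auto simp: n_def)
    \<comment> \<open>Each integration over the free variable produces a volume proportional to the
      \<open>n\<close>-th power of the norm of the other one. This factor lowers the weight exponent
      from \<open>e + 2 * a\<close> to the one occurring in \<open>J\<close>.\<close>
    have h_scale: "h (e + 2 * a) x * ennreal (norm x ^ n) = h (e + 2 * a - n) x" if "x \<noteq> 0" for x
      using that by (simp add: h_def powr_diff powr_realpow flip: ennreal_mult)
    \<comment> \<open>\<open>T\<close> is kept in the far term, where it will restrict the
      integration in \<open>x\<close>, and dropped from the kernel term, which is to be integrated
      over all pairs.\<close>
    have pointwise: "T x y * h (e + 2 * a) x \<le>
        ennreal c1 * K (x, y) + ennreal c2 * (T x y * h (e + 2 * a) y)" for x y
    proof (cases "T x y = 0")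
      case False
      then have T: "T x y = 1" "d < norm x" "R * norm x \<le> norm y" "norm y \<le> 2 * R * norm x"
        by (auto simp: T_def indicator_def split: if_splits)
      then have "x \<noteq> 0" using \<open>0 < d\<close> by auto
      show ?thesis
        using fractional_hardy_pointwise[OF R(1) _ \<open>0 \<le> e\<close> \<open>0 \<le> a\<close> \<open>x \<noteq> 0\<close> T(3,4), of p "w x" "w y"]
          \<open>0 < p\<close> \<open>0 < c1\<close> \<open>0 \<le> c2\<close>
        unfolding T(1) c1_def[symmetric] c2_def[symmetric]
        by (simp add: K_def h_def ennreal_leI flip: ennreal_mult ennreal_plus)
    qed simp
    have "ennreal A * J = (\<integral>\<^sup>+x. ennreal A * (indicator {x. d < norm x} x * h (e + 2 * a - n) x) \<partial>lborel)"
      unfolding J_def truncated_weighted_integral_def h_def by (simp add: nn_integral_cmult)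
    also have "\<dots> \<le> (\<integral>\<^sup>+x. (\<integral>\<^sup>+y. T x y * h (e + 2 * a) x \<partial>lborel) \<partial>lborel)"
    proof (rule nn_integral_mono)
      fix x :: 'a
      show "ennreal A * (indicator {x. d < norm x} x * h (e + 2 * a - n) x) \<le>
          (\<integral>\<^sup>+y. T x y * h (e + 2 * a) x \<partial>lborel)"
      proof (cases "d < norm x")
        case True
        then have "x \<noteq> 0" using \<open>0 < d\<close> by auto
        have T: "T x y = indicator {y. R * norm x < norm y \<and> norm y \<le> 2 * R * norm x} y" for y
          using True by (simp add: T_def indicator_def)
        have "ennreal A * h (e + 2 * a - n) x =
            h (e + 2 * a) x * ennreal (\<nu> * (R * norm x) ^ n)"
          unfolding h_scale[OF \<open>x \<noteq> 0\<close>, symmetric] using R \<open>0 \<le> \<nu>\<close>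
          by (simp add: A_def power_mult_distrib ennreal_mult mult_ac)
        also have "\<dots> \<le> h (e + 2 * a) x *
            emeasure lborel {y::'a. R * norm x < norm y \<and> norm y \<le> 2 * R * norm x}"
          using R emeasure_annulus_ge[of "norm x" R, where 'a='a] unfolding \<nu>_def n_def
          by (intro mult_left_mono) auto
        also have "\<dots> = (\<integral>\<^sup>+y. T x y * h (e + 2 * a) x \<partial>lborel)"
          unfolding T by (subst nn_integral_multc) (auto simp: mult.commute)
        finally show ?thesis using True by simp
      qed simp
    qed
    also have "\<dots> \<le> (\<integral>\<^sup>+x. (\<integral>\<^sup>+y. ennreal c1 * K (x, y) + ennreal c2 * (T x y * h (e + 2 * a) y) \<partial>lborel) \<partial>lborel)"
      by (intro nn_integral_mono pointwise)
    also have "\<dots> = (\<integral>\<^sup>+x. (\<integral>\<^sup>+y. ennreal c1 * K (x, y) \<partial>lborel) \<partial>lborel) +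
        (\<integral>\<^sup>+x. (\<integral>\<^sup>+y. ennreal c2 * (T x y * h (e + 2 * a) y) \<partial>lborel) \<partial>lborel)"
      by (simp add: nn_integral_add lborel.borel_measurable_nn_integral)
    also have "(\<integral>\<^sup>+x. (\<integral>\<^sup>+y. ennreal c1 * K (x, y) \<partial>lborel) \<partial>lborel) = ennreal c1 * D"
      unfolding D_def
      by (subst nn_integral_cmult[symmetric], measurable)
        (rule lborel.nn_integral_fst[of "\<lambda>z. ennreal c1 * K z"], measurable)
    \<comment> \<open>In the far term the weight depends on \<open>y\<close> alone, so the order is
      exchanged to integrate in \<open>x\<close> first.\<close>
    also have "(\<integral>\<^sup>+x. (\<integral>\<^sup>+y. ennreal c2 * (T x y * h (e + 2 * a) y) \<partial>lborel) \<partial>lborel) =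
        (\<integral>\<^sup>+y. (\<integral>\<^sup>+x. ennreal c2 * (T x y * h (e + 2 * a) y) \<partial>lborel) \<partial>lborel)"
      by (rule lborel_pair.Fubini') measurable
    also have "\<dots> \<le> (\<integral>\<^sup>+y. ennreal (A / 2) * (indicator {x. d < norm x} y * h (e + 2 * a - n) y) \<partial>lborel)"
    proof (rule nn_integral_mono)
      fix y :: 'a
      have "(\<integral>\<^sup>+x. ennreal c2 * (T x y * h (e + 2 * a) y) \<partial>lborel) =
          ennreal c2 * (h (e + 2 * a) y * (\<integral>\<^sup>+x. T x y \<partial>lborel))"
        by (subst nn_integral_cmult, measurable, subst nn_integral_multc, measurable)
          (simp add: mult_ac)
      \<comment> \<open>For fixed \<open>y\<close> the admissible \<open>x\<close> lie in the ball
        of radius \<open>norm y / R\<close>. Moreover \<open>d < norm x \<le> norm y\<close>, so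
        \<open>y\<close> inherits the truncation and the far term is again controlled by
        \<open>J\<close>.\<close>
      also have "(\<integral>\<^sup>+x. T x y \<partial>lborel) \<le>
          (\<integral>\<^sup>+x. indicator {x. d < norm x} y * indicator (cball (0::'a) (norm y / R)) x \<partial>lborel)"
      proof (rule nn_integral_mono)
        fix x :: 'a
        have "d < norm y \<and> norm x \<le> norm y / R" if "d < norm x" "R * norm x < norm y"
        proof -
          have "1 * norm x \<le> R * norm x" using R by (intro mult_right_mono) auto
          then show ?thesis using that R by (auto simp: field_simps)
        qed
        then show "T x y \<le> indicator {x. d < norm x} y * indicator (cball (0::'a) (norm y / R)) x"
          by (auto simp: T_def indicator_def)
      qed
      also have "\<dots> = indicator {x. d < norm x} y * ennreal (\<nu> * (norm y / R) ^ n)"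
        using R by (simp add: nn_integral_cmult_indicator emeasure_cball \<nu>_def n_def)
      finally have "(\<integral>\<^sup>+x. ennreal c2 * (T x y * h (e + 2 * a) y) \<partial>lborel) \<le>
          ennreal c2 * (h (e + 2 * a) y * (indicator {x. d < norm x} y * ennreal (\<nu> * (norm y / R) ^ n)))"
        by (simp add: mult_left_mono)
      also have "\<dots> \<le> ennreal (A / 2) * (indicator {x. d < norm x} y * h (e + 2 * a - n) y)"
      proof (cases "d < norm y")
        case True
        then have "y \<noteq> 0" using \<open>0 < d\<close> by auto
        have "ennreal c2 * (h (e + 2 * a) y * ennreal (\<nu> * (norm y / R) ^ n)) =
            ennreal (c2 * (\<nu> / R ^ n)) * h (e + 2 * a - n) y"
          unfolding h_scale[OF \<open>y \<noteq> 0\<close>, symmetric] using R \<open>0 \<le> \<nu>\<close> \<open>0 \<le> c2\<close>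
          by (simp add: power_divide h_def mult_ac flip: ennreal_mult)
        also have "\<dots> \<le> ennreal (A / 2) * h (e + 2 * a - n) y"
          using c2 by (intro mult_right_mono ennreal_leI) auto
        finally show ?thesis using True by simp
      qed simp
      finally show "(\<integral>\<^sup>+x. ennreal c2 * (T x y * h (e + 2 * a) y) \<partial>lborel) \<le>
          ennreal (A / 2) * (indicator {x. d < norm x} y * h (e + 2 * a - n) y)" .
    qed
    also have "\<dots> = ennreal (A / 2) * J"
      unfolding J_def truncated_weighted_integral_def h_def by (simp add: nn_integral_cmult)
    finally have "ennreal A * J \<le> ennreal c1 * D + ennreal (A / 2) * J"
      by (simp add: add_left_mono)
    then have "ennreal (A / 2) * J \<le> ennreal c1 * D"
      by (rule ennreal_absorb_half[OF \<open>J < top\<close> \<open>0 < A\<close>])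
    then have "ennreal (A / 2 / c1) * J \<le> D"
      by (rule ennreal_divide_mult_le) (simp add: \<open>0 < A\<close>, fact)
    then show "ennreal (A / 2 / c1) * truncated_weighted_integral p (e + 2 * a - DIM('a)) d w \<le>
      (\<integral>\<^sup>+(x, y). ennreal (norm (w x - w y) powr p / norm (x - y) powr e
        * (1 / norm x powr a) * (1 / norm y powr a)) \<partial>(lborel \<Otimes>\<^sub>M lborel))"
      by (simp add: J_def D_def K_def n_def)
  qed
qed

section \<open>The weighted Hardy inequality for a function and its gradient\<close>

text \<open>The difference is the integral of the radial derivative
  \<open>inner x (w (t *\<^sub>R x))\<close> over \<open>t\<close> from 1 to \<open>R\<close>, by
  the fundamental theorem of calculus along the ray. A bound for the \<open>p\<close>-th power of
  this integral then gives the claim.\<close>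

lemma abs_diff_dilation_powr_le:
  fixes u :: "'a::euclidean_space \<Rightarrow> real" and w :: "'a \<Rightarrow> 'a"
  assumes u: "\<And>x. GDERIV u x :> w x" and w: "continuous_on UNIV w" and "1 < p" "1 < R"
  shows "ennreal (\<bar>u x - u (R *\<^sub>R x)\<bar> powr p) \<le> ennreal (2 * (2 * R) powr (p - 1)) *
    (\<integral>\<^sup>+t. indicator {1..R} t * ennreal ((norm (w (t *\<^sub>R x)) * norm x) powr p) \<partial>lborel)"
proof (cases "u x = u (R *\<^sub>R x)")
  case False
  define d where "d = \<bar>u x - u (R *\<^sub>R x)\<bar>"
  \<comment> \<open>At this level the constant part of the bound integrates to
    \<open>(R - 1) * m \<le> d / 2\<close>, so at least half of \<open>d\<close> comes from the
    integral of \<open>f t powr p\<close>.\<close>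
  define m where "m = d / (2 * R)"
  define f where "f t = norm (w (t *\<^sub>R x)) * norm x" for t
  have "0 < d" using False by (simp add: d_def)
  then have "0 < m" using \<open>1 < R\<close> by (simp add: m_def)
  have f0: "0 \<le> f t" for t by (simp add: f_def)
  have "continuous_on {1..R} (\<lambda>t. w (t *\<^sub>R x))"
    by (rule continuous_on_compose2[OF w]) (auto intro!: continuous_intros)
  then have f_cont: "continuous_on {1..R} (\<lambda>t. f t powr p)"
    using \<open>1 < p\<close> f0 unfolding f_def by (intro continuous_on_powr' continuous_intros) auto
  define F where "F = integral {1..R} (\<lambda>t. f t powr p)"
  have F: "((\<lambda>t. f t powr p) has_integral F) {1..R}"
    unfolding F_def using f_cont by (intro integrable_integral integrable_continuous_real)
  \<comment> \<open>This links the gauge integral, in which the fundamental theorem of calculus is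
    stated, to the Lebesgue integral of the claim.\<close>
  have F_nn: "(\<integral>\<^sup>+t. indicator {1..R} t * ennreal (f t powr p) \<partial>lborel) = ennreal F"
    using nn_integral_has_integral_lebesgue[OF _ F] by (simp add: ennreal_mult' ennreal_indicator)
  have "((\<lambda>t. u (t *\<^sub>R x)) has_vector_derivative inner x (w (t *\<^sub>R x))) (at t within {1..R})" for t
  proof -
    have "((\<lambda>t. t *\<^sub>R x) has_derivative (\<lambda>h. h *\<^sub>R x)) (at t within {1..R})"
      by (auto intro!: derivative_eq_intros)
    moreover have "(u has_derivative (\<lambda>h. inner h (w (t *\<^sub>R x)))) (at (t *\<^sub>R x))"
      using u by (simp add: gderiv_def)
    ultimately have "((\<lambda>t. u (t *\<^sub>R x)) has_derivative (\<lambda>h. inner (h *\<^sub>R x) (w (t *\<^sub>R x)))) (at t within {1..R})"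
      by (rule has_derivative_compose)
    then show ?thesis
      by (simp add: has_vector_derivative_def)
  qed
  then have u_int: "((\<lambda>t. inner x (w (t *\<^sub>R x))) has_integral (u (R *\<^sub>R x) - u (1 *\<^sub>R x))) {1..R}"
    using \<open>1 < R\<close> by (intro fundamental_theorem_of_calculus) auto
  have bound_int: "((\<lambda>t. m + m powr (1 - p) * f t powr p) has_integral ((R - 1) * m + m powr (1 - p) * F)) {1..R}"
    using has_integral_const_real[of m 1 R] \<open>1 < R\<close>
    by (intro has_integral_add has_integral_mult_right F) simp
  have bound: "norm (inner x (w (t *\<^sub>R x))) \<le> m + m powr (1 - p) * f t powr p" for t
  proof -
    have "norm (inner x (w (t *\<^sub>R x))) \<le> f t"
      using Cauchy_Schwarz_ineq2[of x "w (t *\<^sub>R x)"] by (simp add: f_def mult.commute)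
    \<comment> \<open>The splitting at level \<open>m\<close> replaces Hoelder's inequality.\<close>
    also have "f t \<le> m + m powr (1 - p) * f t powr p"
    proof (cases "f t \<le> m")
      case False
      then have "f t = f t powr (1 - p) * f t powr p"
        using \<open>0 < m\<close> by (simp flip: powr_add)
      also have "\<dots> \<le> m powr (1 - p) * f t powr p"
        using False \<open>0 < m\<close> \<open>1 < p\<close> by (intro mult_right_mono powr_mono2') auto
      finally show ?thesis using \<open>0 < m\<close> by simp
    qed (simp add: add_increasing2)
    finally show ?thesis .
  qed
  have "d = norm (integral {1..R} (\<lambda>t. inner x (w (t *\<^sub>R x))))"
    using u_int by (simp add: d_def integral_unique abs_minus_commute)
  also have "\<dots> \<le> integral {1..R} (\<lambda>t. m + m powr (1 - p) * f t powr p)"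
    using u_int bound_int bound by (intro integral_norm_bound_integral) (auto simp: has_integral_integrable)
  also have "\<dots> = (R - 1) * m + m powr (1 - p) * F"
    using bound_int by (rule integral_unique)
  also have "(R - 1) * m \<le> d / 2"
    using \<open>1 < R\<close> \<open>0 < d\<close> by (simp add: m_def field_simps)
  finally have "d / 2 \<le> m powr (1 - p) * F"
    by simp
  \<comment> \<open>Multiplying by \<open>m powr (p - 1)\<close> clears \<open>m\<close> on the
    right; on the left \<open>m\<close> is a multiple of \<open>d\<close>, which produces
    \<open>d powr p\<close> and the stated constant.\<close>
  then have "m powr (p - 1) * (d / 2) \<le> m powr (p - 1) * (m powr (1 - p) * F)"
    by (rule mult_left_mono) simp
  also have "\<dots> = F"
    using \<open>0 < m\<close> by (simp flip: mult.assoc powr_add)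
  also have "m powr (p - 1) * (d / 2) = d powr p / (2 * (2 * R) powr (p - 1))"
    using \<open>0 < d\<close> \<open>1 < R\<close> by (simp add: m_def powr_divide powr_diff)
  finally have "d powr p \<le> 2 * (2 * R) powr (p - 1) * F"
    using \<open>1 < R\<close> by (simp add: field_simps)
  then have "ennreal (d powr p) \<le> ennreal (2 * (2 * R) powr (p - 1)) * ennreal F"
    by (subst ennreal_mult'[symmetric]) (auto intro: ennreal_leI)
  then show ?thesis
    unfolding F_nn[symmetric] by (simp add: d_def f_def)
qed simp

text \<open>Substituting \<open>R *\<^sub>R x\<close> in the far term
  \<open>u (R *\<^sub>R x)\<close> yields the factor \<open>R powr (\<gamma> - n)\<close>, which is
  small because \<open>\<gamma> < n\<close>. The difference term is an integral over dilates of
  \<open>w\<close>, and dilating outwards does not increase the weighted integral of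
  \<open>w\<close>.\<close>

theorem weighted_hardy:
  fixes p \<gamma> :: real
  assumes "1 < p" "0 \<le> \<gamma>" "\<gamma> < real DIM('a)"
  shows "\<exists>C>0. \<forall>(u :: 'a::euclidean_space \<Rightarrow> real) w. (\<forall>x. GDERIV u x :> w x) \<longrightarrow>
    continuous_on UNIV w \<longrightarrow> bounded {x. u x \<noteq> 0} \<longrightarrow>
    ennreal C * (\<integral>\<^sup>+x. ennreal (\<bar>u x\<bar> powr p / norm x powr \<gamma>) \<partial>lborel)
      \<le> (\<integral>\<^sup>+x. ennreal (norm (w x) powr p / norm x powr (\<gamma> - p)) \<partial>lborel)"
proof -
  define n where "n = DIM('a)"
  \<comment> \<open>Equivalent to \<open>2 powr p * R powr (\<gamma> - n) \<le> 1 / 2\<close>, the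
    coefficient with which \<open>J\<close> reappears on the right.\<close>
  obtain R where R: "1 < R" "2 * 2 powr p \<le> R powr (real n - \<gamma>)"
    using exists_large_powr[of "real n - \<gamma>"] assms unfolding n_def by auto
  \<comment> \<open>\<open>c\<close> is the constant of the dilation estimate; \<open>c1\<close>
    also collects the factor \<open>2 powr p\<close> of the splitting and the length
    \<open>R - 1\<close> of the range of \<open>t\<close>.\<close>
  define c where "c = 2 * (2 * R) powr (p - 1)"
  define c1 where "c1 = 2 powr p * (c * (R - 1))"
  have "0 < c" "0 < c1"
    using R by (auto simp: c_def c1_def)
  have half: "2 powr p * R powr (\<gamma> - n) \<le> 1 / 2"
    using R by (simp add: powr_diff field_simps)
  show ?thesis
  proof (intro exI[of _ "1 / 2 / c1"] conjI allI impI)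
    show "0 < 1 / 2 / c1" using \<open>0 < c1\<close> by simp
    fix u :: "'a \<Rightarrow> real" and w
    assume u: "\<forall>x. GDERIV u x :> w x" and w: "continuous_on UNIV w" and supp: "bounded {x. u x \<noteq> 0}"
    have u_cont: "continuous_on UNIV u"
      using u has_derivative_continuous unfolding gderiv_def
      by (intro continuous_at_imp_continuous_on) blast
    have [measurable]: "u \<in> borel_measurable borel" "w \<in> borel_measurable borel"
      using u_cont w by (auto intro: borel_measurable_continuous_onI)
    define g where "g x = ennreal (norm (w x) powr p / norm x powr (\<gamma> - p))" for x
    define h where "h x = ennreal (\<bar>u x\<bar> powr p / norm x powr \<gamma>)" for x
    have [measurable]: "g \<in> borel_measurable borel" "h \<in> borel_measurable borel"
      unfolding g_def h_def by measurable
    define E where "E = (\<integral>\<^sup>+x. g x \<partial>lborel)"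
    have truncated: "ennreal (1 / 2) * (\<integral>\<^sup>+x. indicator {x. d < norm x} x * h x \<partial>lborel) \<le> ennreal c1 * E"
      if "0 < d" for d
    proof -
      define J where "J = truncated_weighted_integral p \<gamma> d u"
      have J_eq: "J = (\<integral>\<^sup>+x. indicator {x. d < norm x} x * h x \<partial>lborel)"
        by (simp add: J_def truncated_weighted_integral_def h_def)
      have "J < top"
        unfolding J_def using assms \<open>0 < d\<close> u_cont supp
        by (intro truncated_weighted_integral_finite) auto
      define I where "I x = (indicator {x::'a. d < norm x} x :: ennreal)" for x
      have [measurable]: "I \<in> borel_measurable borel"
        unfolding I_def by measurable
      define A where "A t x = ennreal ((norm (w (t *\<^sub>R x)) * norm x) powr p / norm x powr \<gamma>)" for t x
      have [measurable]: "case_prod A \<in> borel_measurable (lborel \<Otimes>\<^sub>M lborel)"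
        unfolding A_def by measurable
      have pointwise: "I x * h x \<le>
          ennreal (2 powr p * c) * (I x * (\<integral>\<^sup>+t. indicator {1..R} t * A t x \<partial>lborel)) +
          ennreal (2 powr p * R powr \<gamma>) * (I x * h (R *\<^sub>R x))" for x
      proof (cases "d < norm x")
        case True
        then have "x \<noteq> 0" using \<open>0 < d\<close> by auto
        have "\<bar>u x\<bar> powr p / norm x powr \<gamma> \<le>
            2 powr p * (\<bar>u x - u (R *\<^sub>R x)\<bar> powr p + \<bar>u (R *\<^sub>R x)\<bar> powr p) / norm x powr \<gamma>"
          using norm_powr_le_2_powr[of p "u x" "u (R *\<^sub>R x)"] \<open>1 < p\<close> by (intro divide_right_mono) auto
        also have "\<dots> = 2 powr p * (\<bar>u x - u (R *\<^sub>R x)\<bar> powr p * (1 / norm x powr \<gamma>)) +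
            2 powr p * R powr \<gamma> * (\<bar>u (R *\<^sub>R x)\<bar> powr p / norm (R *\<^sub>R x) powr \<gamma>)"
          using R \<open>x \<noteq> 0\<close> by (simp add: powr_mult field_simps)
        finally have "h x \<le> ennreal (2 powr p) * (ennreal (\<bar>u x - u (R *\<^sub>R x)\<bar> powr p) * ennreal (1 / norm x powr \<gamma>)) +
            ennreal (2 powr p * R powr \<gamma>) * h (R *\<^sub>R x)"
          unfolding h_def by (simp add: ennreal_leI flip: ennreal_mult ennreal_plus)
        also have "\<dots> \<le> ennreal (2 powr p) * ((ennreal c * (\<integral>\<^sup>+t. indicator {1..R} t *
              ennreal ((norm (w (t *\<^sub>R x)) * norm x) powr p) \<partial>lborel)) * ennreal (1 / norm x powr \<gamma>)) +
            ennreal (2 powr p * R powr \<gamma>) * h (R *\<^sub>R x)"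
          unfolding c_def using u w \<open>1 < p\<close> R
          by (intro add_right_mono mult_left_mono mult_right_mono abs_diff_dilation_powr_le) auto
        also have "(ennreal c * (\<integral>\<^sup>+t. indicator {1..R} t *
              ennreal ((norm (w (t *\<^sub>R x)) * norm x) powr p) \<partial>lborel)) * ennreal (1 / norm x powr \<gamma>) =
            ennreal c * (\<integral>\<^sup>+t. (indicator {1..R} t *
              ennreal ((norm (w (t *\<^sub>R x)) * norm x) powr p)) * ennreal (1 / norm x powr \<gamma>) \<partial>lborel)"
          by (subst nn_integral_multc) (auto simp: mult.assoc)
        also have "(\<integral>\<^sup>+t. (indicator {1..R} t *
              ennreal ((norm (w (t *\<^sub>R x)) * norm x) powr p)) * ennreal (1 / norm x powr \<gamma>) \<partial>lborel) =
            (\<integral>\<^sup>+t. indicator {1..R} t * A t x \<partial>lborel)"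
          by (simp add: A_def mult.assoc flip: ennreal_mult)
        finally show ?thesis
          using True \<open>0 < c\<close> by (simp add: I_def ennreal_mult mult.assoc)
      qed (simp add: I_def)
      \<comment> \<open>Substituting \<open>t *\<^sub>R x\<close> gives the factor
        \<open>t powr (\<gamma> - p - n)\<close>, which is at most 1 for \<open>t \<ge> 1\<close>
        since the exponent is negative. The bound is thus uniform in \<open>t\<close>.\<close>
      have A_bound: "(\<integral>\<^sup>+x. I x * (indicator {1..R} t * A t x) \<partial>lborel) \<le> E * indicator {1..R} t" for t
      proof (cases "t \<in> {1..R}")
        case True
        then have "0 < t" by simp
        have "I x * A t x \<le> ennreal (t powr (\<gamma> - p)) * g (t *\<^sub>R x)" for x
        proof (cases "d < norm x")
          case True
          have "(norm (w (t *\<^sub>R x)) * norm x) powr p / norm x powr \<gamma> =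
              norm (w (t *\<^sub>R x)) powr p / norm x powr (\<gamma> - p)"
            by (simp add: powr_mult powr_diff)
          also have "\<dots> = t powr (\<gamma> - p) * (norm (w (t *\<^sub>R x)) powr p / norm (t *\<^sub>R x) powr (\<gamma> - p))"
            using \<open>0 < t\<close> by (simp add: powr_mult)
          finally have "A t x = ennreal (t powr (\<gamma> - p)) * g (t *\<^sub>R x)"
            unfolding A_def g_def by (simp only: ennreal_mult' powr_ge_zero)
          then show ?thesis
            by (simp add: I_def indicator_def)
        qed (simp add: I_def)
        then have "(\<integral>\<^sup>+x. I x * A t x \<partial>lborel) \<le> (\<integral>\<^sup>+x. ennreal (t powr (\<gamma> - p)) * g (t *\<^sub>R x) \<partial>lborel)"
          by (intro nn_integral_mono)
        also have "\<dots> = ennreal (t powr (\<gamma> - p)) * (ennreal (1 / t ^ n) * E)"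
          using \<open>0 < t\<close> by (simp add: nn_integral_cmult nn_integral_lborel_scaleR E_def n_def)
        also have "\<dots> = ennreal (t powr (\<gamma> - p - n)) * E"
          using \<open>0 < t\<close> by (simp add: powr_diff powr_realpow flip: mult.assoc ennreal_mult)
        also have "\<dots> \<le> 1 * E"
        proof (intro mult_right_mono)
          have "t powr (\<gamma> - p - n) \<le> t powr 0"
            using True assms by (intro powr_mono) (auto simp: n_def)
          then show "ennreal (t powr (\<gamma> - p - n)) \<le> 1"
            using \<open>0 < t\<close> by (simp add: ennreal_le_1)
        qed simp
        finally show ?thesis using True by simp
      qed simp
      have A_total: "(\<integral>\<^sup>+x. I x * (\<integral>\<^sup>+t. indicator {1..R} t * A t x \<partial>lborel) \<partial>lborel) \<le> ennreal (R - 1) * E"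
      proof -
        have "(\<integral>\<^sup>+x. I x * (\<integral>\<^sup>+t. indicator {1..R} t * A t x \<partial>lborel) \<partial>lborel) =
            (\<integral>\<^sup>+x. (\<integral>\<^sup>+t. I x * (indicator {1..R} t * A t x) \<partial>lborel) \<partial>lborel)"
          by (simp add: nn_integral_cmult)
        also have "\<dots> = (\<integral>\<^sup>+t. (\<integral>\<^sup>+x. I x * (indicator {1..R} t * A t x) \<partial>lborel) \<partial>lborel)"
          by (rule lborel_pair.Fubini') measurable
        also have "\<dots> \<le> (\<integral>\<^sup>+t. E * indicator {1..R} t \<partial>lborel)"
          by (intro nn_integral_mono A_bound)
        also have "\<dots> = ennreal (R - 1) * E"
          using R by (simp add: nn_integral_cmult_indicator mult.commute)
        finally show ?thesis .
      qed
      \<comment> \<open>Since \<open>R > 1\<close>, the region \<open>d < norm x\<close> is mapped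
        into itself by the dilation, so the substitution leads back to the same truncated integral
        \<open>J\<close>.\<close>
      have h_total: "(\<integral>\<^sup>+x. I x * h (R *\<^sub>R x) \<partial>lborel) \<le> ennreal (1 / R ^ n) * J"
      proof -
        have "(\<integral>\<^sup>+x. I x * h (R *\<^sub>R x) \<partial>lborel) \<le> (\<integral>\<^sup>+x. I (R *\<^sub>R x) * h (R *\<^sub>R x) \<partial>lborel)"
        proof (intro nn_integral_mono mult_right_mono)
          fix x :: 'a
          have "1 * norm x \<le> R * norm x" using R by (intro mult_right_mono) auto
          then show "I x \<le> I (R *\<^sub>R x)"
            using R by (auto simp: I_def indicator_def)
        qed simp
        also have "\<dots> = ennreal (1 / R ^ n) * J"
          using R nn_integral_lborel_scaleR[of "\<lambda>x. I x * h x" R] by (simp add: J_eq I_def n_def)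
        finally show ?thesis .
      qed
      have "ennreal 1 * J = (\<integral>\<^sup>+x. I x * h x \<partial>lborel)"
        by (simp add: J_eq I_def)
      also have "\<dots> \<le> (\<integral>\<^sup>+x. ennreal (2 powr p * c) * (I x * (\<integral>\<^sup>+t. indicator {1..R} t * A t x \<partial>lborel)) +
          ennreal (2 powr p * R powr \<gamma>) * (I x * h (R *\<^sub>R x)) \<partial>lborel)"
        by (intro nn_integral_mono pointwise)
      also have "\<dots> = ennreal (2 powr p * c) * (\<integral>\<^sup>+x. I x * (\<integral>\<^sup>+t. indicator {1..R} t * A t x \<partial>lborel) \<partial>lborel) +
          ennreal (2 powr p * R powr \<gamma>) * (\<integral>\<^sup>+x. I x * h (R *\<^sub>R x) \<partial>lborel)"
        by (simp add: nn_integral_add nn_integral_cmult)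
      also have "\<dots> \<le> ennreal (2 powr p * c) * (ennreal (R - 1) * E) +
          ennreal (2 powr p * R powr \<gamma>) * (ennreal (1 / R ^ n) * J)"
        using A_total h_total by (intro add_mono mult_left_mono) auto
      also have "\<dots> = ennreal c1 * E + ennreal (2 powr p * R powr (\<gamma> - n)) * J"
        using R \<open>0 < c\<close> by (simp add: c1_def powr_diff powr_realpow mult.assoc flip: ennreal_mult mult.assoc)
      also have "\<dots> \<le> ennreal c1 * E + ennreal (1 / 2) * J"
        using half by (intro add_left_mono mult_right_mono ennreal_leI) auto
      finally show ?thesis
        unfolding J_eq[symmetric] by (intro ennreal_absorb_half[OF \<open>J < top\<close>]) auto
    qed
    \<comment> \<open>The bound \<open>c1 * E\<close> does not depend on \<open>d\<close>, so the
      truncation can now be removed.\<close>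
    have "(\<integral>\<^sup>+x. ennreal (1 / 2) * h x \<partial>lborel) \<le> ennreal c1 * E"
    proof (rule nn_integral_le_of_truncations)
      fix d :: real assume "0 < d"
      have "(\<integral>\<^sup>+x. indicator {x. d < norm x} x * (ennreal (1 / 2) * h x) \<partial>lborel) =
          ennreal (1 / 2) * (\<integral>\<^sup>+x. indicator {x. d < norm x} x * h x \<partial>lborel)"
        by (subst mult.left_commute, rule nn_integral_cmult) measurable
      also have "\<dots> \<le> ennreal c1 * E"
        using \<open>0 < d\<close> by (rule truncated)
      finally show "(\<integral>\<^sup>+x. indicator {x. d < norm x} x * (ennreal (1 / 2) * h x) \<partial>lborel) \<le> ennreal c1 * E" .
    \<comment> \<open>At the origin \<open>0 powr \<gamma>\<close> is 0 and division by 0 gives 0,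
      hence \<open>h 0 = 0\<close>.\<close>
    qed (simp_all add: h_def)
    then have "ennreal (1 / 2) * (\<integral>\<^sup>+x. h x \<partial>lborel) \<le> ennreal c1 * E"
      by (subst (asm) nn_integral_cmult) simp_all
    then have "ennreal (1 / 2 / c1) * (\<integral>\<^sup>+x. h x \<partial>lborel) \<le> E"
      by (rule ennreal_divide_mult_le) (simp, fact)
    then show "ennreal (1 / 2 / c1) * (\<integral>\<^sup>+x. ennreal (\<bar>u x\<bar> powr p / norm x powr \<gamma>) \<partial>lborel)
      \<le> (\<integral>\<^sup>+x. ennreal (norm (w x) powr p / norm x powr (\<gamma> - p)) \<partial>lborel)"
      by (simp only: E_def h_def g_def)
  qed
qed

section \<open>Gradients of test functions\<close>

text \<open>Uniqueness is what allows \<open>grad\<close>, a definite description, to be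
  evaluated.\<close>

lemma GDERIV_unique:
  assumes "GDERIV f x :> D" "GDERIV f x :> D'"
  shows "D = D'"
proof -
  have "(\<lambda>h. inner h D) = (\<lambda>h. inner h D')"
    using assms unfolding gderiv_def by (rule has_derivative_unique)
  then show ?thesis
    by (metis inner_commute vector_eq_ldot)
qed

lemma grad_eq:
  fixes f :: "'a::euclidean_space \<Rightarrow> real"
  assumes "GDERIV f x :> D"
  shows "grad f x = D"
  unfolding grad_def using assms GDERIV_unique by blast

text \<open>Expanding the direction in the orthonormal basis and using linearity represents the
  derivative by the vector of partial derivatives. In this form continuity of the gradient reduces
  to that of directional derivatives, which \<open>Ck\<close> supplies.\<close>

lemma GDERIV_frechet_derivative:
  fixes f :: "'a::euclidean_space \<Rightarrow> real"
  assumes "f differentiable (at x)"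
  shows "GDERIV f x :> (\<Sum>b\<in>Basis. frechet_derivative f (at x) b *\<^sub>R b)"
proof -
  have lin: "linear (frechet_derivative f (at x))"
    using assms by (rule linear_frechet_derivative)
  have "frechet_derivative f (at x) h = inner h (\<Sum>b\<in>Basis. frechet_derivative f (at x) b *\<^sub>R b)" for h
  proof -
    have "frechet_derivative f (at x) h = frechet_derivative f (at x) (\<Sum>b\<in>Basis. inner h b *\<^sub>R b)"
      by (simp add: euclidean_representation)
    also have "\<dots> = (\<Sum>b\<in>Basis. inner h b * frechet_derivative f (at x) b)"
      using lin by (simp add: linear_sum linear_scale)
    finally show ?thesis
      by (simp add: inner_sum_right mult.commute)
  qed
  then have "frechet_derivative f (at x) = (\<lambda>h. inner h (\<Sum>b\<in>Basis. frechet_derivative f (at x) b *\<^sub>R b))"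
    by (rule ext)
  then show ?thesis
    using assms unfolding gderiv_def by (metis frechet_derivative_works)
qed

lemma Cc_infty_grad:
  fixes u :: "'a::euclidean_space \<Rightarrow> real"
  assumes "u \<in> Cc_infty"
  shows "GDERIV u x :> grad u x" "continuous_on UNIV (grad u)"
    "bounded {x. u x \<noteq> 0}" "bounded {x. grad u x \<noteq> 0}"
proof -
  have "Ck (Suc 0) u" and compact: "compact (closure {x. u x \<noteq> 0})"
    using assms by (auto simp: Cc_infty_def simp del: Ck.simps)
  then have diff: "u differentiable (at x)"
    and cont: "continuous_on UNIV (\<lambda>x. frechet_derivative u (at x) v)" for x v
    by auto
  have grad: "grad u = (\<lambda>x. \<Sum>b\<in>Basis. frechet_derivative u (at x) b *\<^sub>R b)"
    by (intro ext grad_eq GDERIV_frechet_derivative diff)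
  show "GDERIV u x :> grad u x" for x
    unfolding grad by (intro GDERIV_frechet_derivative diff)
  show "continuous_on UNIV (grad u)"
    unfolding grad by (intro continuous_intros cont)
  have bdd: "bounded (closure {x. u x \<noteq> 0})"
    using compact by (rule compact_imp_bounded)
  then show "bounded {x. u x \<noteq> 0}"
    by (rule bounded_subset) (rule closure_subset)
  \<comment> \<open>Off the closed support, \<open>u\<close> coincides with the zero function on an
    open neighbourhood, so the gradient vanishes there as well.\<close>
  have "grad u x = 0" if "x \<notin> closure {x. u x \<noteq> 0}" for x
  proof (rule grad_eq)
    have "GDERIV (\<lambda>_. 0) x :> 0"
      by (rule GDERIV_const)
    then show "GDERIV u x :> 0"
      unfolding gderiv_def
    proof (rule has_derivative_transform_within_open)
      show "open (- closure {x. u x \<noteq> 0})" "x \<in> - closure {x. u x \<noteq> 0}"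
        using that by auto
      show "0 = u y" if "y \<in> - closure {x. u x \<noteq> 0}" for y
        using that closure_subset[of "{x. u x \<noteq> 0}"] by auto
    qed
  qed
  then show "bounded {x. grad u x \<noteq> 0}"
    by (intro bounded_subset[OF bdd]) auto
qed

section \<open>Composition of the two Hardy inequalities\<close>

theorem proposition5p2:
  fixes N :: nat and s \<sigma> p a :: real
  assumes "CARD('n::finite) = N" and "N \<ge> 2"
    and "1 < s" and "s < 2" and "\<sigma> = s - 1"
    and "1 < p" and "p < real N / s"
    and "0 \<le> a" and "a < (real N - s * p) / 2"
  shows "\<exists>C::real. C > 0 \<and> (\<forall>u \<in> (Cc_infty :: (real^'n \<Rightarrow> real) set).
    (\<integral>\<^sup>+(x, y). ennreal (norm (grad u x - grad u y) powr p / norm (x - y) powr (real N + \<sigma> * p)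
        * (1 / norm x powr a) * (1 / norm y powr a)) \<partial>(lborel \<Otimes>\<^sub>M lborel))
    \<ge> ennreal C * (\<integral>\<^sup>+x. ennreal (\<bar>u x\<bar> powr p / norm x powr (s * p + 2 * a)) \<partial>lborel))"
proof -
  define e where "e = real N + \<sigma> * p"
  define \<gamma> where "\<gamma> = s * p + 2 * a"
  have N: "DIM(real^'n) = N"
    using assms(1) by simp
  \<comment> \<open>The bound \<open>\<gamma> < real N\<close> is the upper bound on
    \<open>a\<close> rearranged.\<close>
  have \<gamma>: "1 < p" "0 \<le> \<gamma>" "\<gamma> < real N"
    using assms by (auto simp: \<gamma>_def)
  \<comment> \<open>Since \<open>s * p - p = \<sigma> * p\<close>, the weight on the gradient in the
    second inequality is exactly the one bounded by the first. The condition
    \<open>e + 2 * a < 2 * real N\<close> follows from this identity and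
    \<open>\<gamma> < real N\<close>.\<close>
  have "0 \<le> \<sigma> * p" "\<gamma> - p = e + 2 * a - real N"
    using assms by (auto simp: \<gamma>_def e_def algebra_simps)
  then have e: "0 < p" "0 \<le> a" "real N \<le> e + 2 * a" "e + 2 * a < 2 * real N" "0 \<le> e"
    using \<gamma> assms by (auto simp: e_def)
  obtain C1 where "0 < C1" and C1: "\<And>w :: real^'n \<Rightarrow> real^'n. continuous_on UNIV w \<Longrightarrow> bounded {x. w x \<noteq> 0} \<Longrightarrow>
    (\<forall>d>0. ennreal C1 * truncated_weighted_integral p (\<gamma> - p) d w \<le>
    (\<integral>\<^sup>+(x, y). ennreal (norm (w x - w y) powr p / norm (x - y) powr e
        * (1 / norm x powr a) * (1 / norm y powr a)) \<partial>(lborel \<Otimes>\<^sub>M lborel)))"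
    using fractional_hardy[where 'a="real^'n" and 'b="real^'n" and p=p and e=e and a=a] e
    unfolding N \<open>\<gamma> - p = e + 2 * a - real N\<close> by blast
  obtain C2 where "0 < C2" and C2: "\<And>(u :: real^'n \<Rightarrow> real) w. (\<forall>x. GDERIV u x :> w x) \<Longrightarrow>
    continuous_on UNIV w \<Longrightarrow> bounded {x. u x \<noteq> 0} \<Longrightarrow>
    ennreal C2 * (\<integral>\<^sup>+x. ennreal (\<bar>u x\<bar> powr p / norm x powr \<gamma>) \<partial>lborel)
      \<le> (\<integral>\<^sup>+x. ennreal (norm (w x) powr p / norm x powr (\<gamma> - p)) \<partial>lborel)"
    using weighted_hardy[where 'a="real^'n" and p=p and \<gamma>=\<gamma>] \<gamma> unfolding N by blast
  show ?thesis
  proof (intro exI[of _ "C1 * C2"] conjI ballI)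
    show "0 < C1 * C2"
      using \<open>0 < C1\<close> \<open>0 < C2\<close> by simp
    fix u :: "real^'n \<Rightarrow> real" assume "u \<in> Cc_infty"
    note u = Cc_infty_grad[OF this]
    have [measurable]: "grad u \<in> borel_measurable borel"
      using u(2) by (rule borel_measurable_continuous_onI)
    define D where "D = (\<integral>\<^sup>+(x, y). ennreal (norm (grad u x - grad u y) powr p / norm (x - y) powr e
        * (1 / norm x powr a) * (1 / norm y powr a)) \<partial>(lborel \<Otimes>\<^sub>M lborel))"
    define g where "g x = ennreal (norm (grad u x) powr p / norm x powr (\<gamma> - p))" for x
    have [measurable]: "g \<in> borel_measurable borel"
      unfolding g_def by measurable
    \<comment> \<open>Neither \<open>C1\<close> nor \<open>D\<close> depends on \<open>d\<close>, so
      the bounds for the truncated integrals pass to the full gradient integral.\<close>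
    have "(\<integral>\<^sup>+x. ennreal C1 * g x \<partial>lborel) \<le> D"
    proof (rule nn_integral_le_of_truncations)
      fix d :: real assume "0 < d"
      have "(\<integral>\<^sup>+x. indicator {x. d < norm x} x * (ennreal C1 * g x) \<partial>lborel) =
          ennreal C1 * truncated_weighted_integral p (\<gamma> - p) d (grad u)"
        unfolding truncated_weighted_integral_def g_def[symmetric]
        by (simp add: mult.left_commute nn_integral_cmult)
      also have "\<dots> \<le> D"
        unfolding D_def using C1[OF u(2,4)] \<open>0 < d\<close> by blast
      finally show "(\<integral>\<^sup>+x. indicator {x. d < norm x} x * (ennreal C1 * g x) \<partial>lborel) \<le> D" .
    qed (auto simp: g_def)
    then have "ennreal C1 * (\<integral>\<^sup>+x. g x \<partial>lborel) \<le> D"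
      by (simp add: nn_integral_cmult)
    moreover have "ennreal C1 * (ennreal C2 * (\<integral>\<^sup>+x. ennreal (\<bar>u x\<bar> powr p / norm x powr \<gamma>) \<partial>lborel)) \<le>
        ennreal C1 * (\<integral>\<^sup>+x. g x \<partial>lborel)"
      unfolding g_def using u by (intro mult_left_mono C2) auto
    ultimately have "ennreal (C1 * C2) * (\<integral>\<^sup>+x. ennreal (\<bar>u x\<bar> powr p / norm x powr \<gamma>) \<partial>lborel) \<le> D"
      using \<open>0 < C1\<close> \<open>0 < C2\<close> by (simp add: ennreal_mult mult.assoc)
    then show "(\<integral>\<^sup>+(x, y). ennreal (norm (grad u x - grad u y) powr p / norm (x - y) powr (real N + \<sigma> * p)
        * (1 / norm x powr a) * (1 / norm y powr a)) \<partial>(lborel \<Otimes>\<^sub>M lborel))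
      \<ge> ennreal (C1 * C2) * (\<integral>\<^sup>+x. ennreal (\<bar>u x\<bar> powr p / norm x powr (s * p + 2 * a)) \<partial>lborel)"
      unfolding D_def e_def \<gamma>_def .
  qed
qed

end
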